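(* Under the standing assumptions (A1)–(A6) described in the context, let $\varepsilon>0$ and $\alpha\in(1,\alpha_0)$. Let $$\mathcal U(\varepsilon,\alpha)=\Big\{\mathfrak u\subset\mathbb N,\ |\mathfrak u|<\infty:\ (C_{\mathfrak u}B_{\mathfrak u})^{1-1/\alpha}>\frac{\varepsilon/2}{\sum_{|\mathfrak v|<\infty}(C_{\mathfrak v}B_{\mathfrak v})^{1/\alpha}}\Big\},$$ and for $\mathfrak u\in\mathcal U(\varepsilon,\alpha)$ let $n_{\mathfrak u}=\lfloor h_{\mathfrak u}\rfloor$, where $$h_{\mathfrak u}=\Big(\frac2\varepsilon\sum_{\mathfrak v\in\mathcal U(\varepsilon,\alpha)}\pounds(|\mathfrak v|)^{q/(q+1)}(G_{\mathfrak v,q}B_{\mathfrak v})^{1/(q+1)}\Big)^{1/q}\Big(\frac{G_{\mathfrak u,q}B_{\mathfrak u}}{\pounds(|\mathfrak u|)}\Big)^{1/(q+1)}.$$ Then the algorithm $$\mathcal A_\varepsilon(f)=\sum_{\mathfrak u\in\mathcal U(\varepsilon,\alpha)}A_{\mathfrak u,n_{\mathfrak u}}(f_{\mathfrak u})$$ approximates the integral $\mathcal I$ with worst case error $$e(\mathcal A_\varepsilon;\mathcal F):=\sup_{f\in\mathcal F}|\mathcal I(f)-\mathcal A_\varepsilon(f)|\le\varepsilon,$$ and its information cost $\mathrm{cost}(\mathcal A_\varepsilon):=\sum_{\mathfrak u\in\mathcal U(\varepsilon,\alpha)}n_{\mathfrak u}\,\pounds(|\mathfrak u|)$ satisfies $$\mathrm{cost}(\mathcal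 A_\varepsilon)\le\sum_{\mathfrak u\in\mathcal U(\varepsilon,\alpha)}h_{\mathfrak u}\,\pounds(|\mathfrak u|)\le\Big(\frac2\varepsilon\Big)^{1/q}\Big(\sum_{\mathfrak u\in\mathcal U(\varepsilon,\alpha)}\pounds(|\mathfrak u|)^{q/(q+1)}(G_{\mathfrak u,q}B_{\mathfrak u})^{1/(q+1)}\Big)^{1+1/q}$$ $$\le\Big(\frac2\varepsilon\Big)^{1/q}\Big(\sum_{\mathfrak u\in\mathcal U(\varepsilon,\alpha)}(G_{\mathfrak u,q}B_{\mathfrak u})^{1/(q+1)}\Big)^{1+1/q}\max_{\mathfrak u\in\mathcal U(\varepsilon,\alpha)}\pounds(|\mathfrak u|).$$
   Context: $D\subseteq\mathbb R$ is a Borel set, $\mu_1$ is the probability measure on $D$ with density $\rho$, $\mu=\times_{j=1}^\infty\mu_1$ on $D^{\mathbb N}$, $\mathbb N=\{1,2,\ldots\}$, and $\mathcal I(f)=\int_{D^{\mathbb N}}f\,\mathrm d\mu$. The letters $\mathfrak u,\mathfrak v$ denote finite subsets of $\mathbb N$, $\boldsymbol x_{\mathfrak u}=(x_j)_{j\in\mathfrak u}$, $D^{\mathfrak u}$ is the product domain $D^{|\mathfrak u|}$ for $\boldsymbol x_{\mathfrak u}$, $\rho_{\mathfrak u}(\boldsymbol x_{\mathfrak u})=\prod_{j\in\mathfrak u}\rho(x_j)$, and $I_{\mathfrak u}(f_{\mathfrak u})=\int_{D^{|\mathfrak u|}}f_{\mathfrak u}(\boldsymbol x_{\mathfrak u})\rho_{\mathfrak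 u}(\boldsymbol x_{\mathfrak u})\,\mathrm d\boldsymbol x_{\mathfrak u}$ (with $I_\emptyset(f_\emptyset)=f_\emptyset$). Infinite sums over finite subsets are understood as $\sum_{|\mathfrak u|<\infty}(\cdot)=\lim_{d\to\infty}\sum_{\mathfrak u\subseteq\{1,\ldots,d\}}(\cdot)$. A maximum over the empty set is read as $0$. A sequence of integrable functions $f_d$ converges dominantly to $f$ if $f_d\to f$ $\mu$-a.e. and there is an integrable $g$ with $|f_d|\le|g|$ $\mu$-a.e. for all $d$. Standing assumptions, for a class $\mathcal F$ of real-valued functions on $D^{\mathbb N}$: (A1) Each $f\in\mathcal F$ has a (given) decomposition $f=\sum_{|\mathfrak u|<\infty}f_{\mathfrak u}$, where $f_{\mathfrak u}$ depends only on the variables $x_j$ with $j\in\mathfrak u$, and the functions $f_d=\sum_{\mathfrak u\subseteq\{1,\ldots,d\}}f_{\mathfrak u}$ converge dominantly to $f$. (A2) Each $f_{\mathfrak u}$ belongs to a normed space $F_{\mathfrak u}$ of real-valued measurable functions on $D^{\mathfrak u}$, and $\|f_{\mathfrak u}\|_{F_{\mathfrak u}}\le B_{\mathfrak u}$ for known positive numbers $B_{\mathfrak u}$. $F_\emptyset$ is the space of constants with the absolute value as norm. Point evaluation at any $\boldsymbol x_{\mathfrak u}\in D^{\mathfrak u}$ is a continuous linear functional on $F_{\mathfrak u}$. (A3) All functions in $F_{\mathfrak u}$ are Lebesgue measurable and integrable with respect to $\rho_{\mathfrak u}(\boldsymbol x_{\mathfrak u})\,\mathrm d\boldsymbol x_{\mathfrak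 u}$, and $C_{\mathfrak u}:=\|I_{\mathfrak u}\|=\sup_{\|f_{\mathfrak u}\|_{F_{\mathfrak u}}\le1}|I_{\mathfrak u}(f_{\mathfrak u})|<\infty$. (A4) $\alpha_0:=\sup\{\alpha:\ \sum_{|\mathfrak u|<\infty}(C_{\mathfrak u}B_{\mathfrak u})^{1/\alpha}<\infty\}>1$. (A5) For each finite $\mathfrak u$, the value $f_{\mathfrak u}(\boldsymbol x_{\mathfrak u})$ can be evaluated at any $\boldsymbol x_{\mathfrak u}\in D^{|\mathfrak u|}$ at cost $\pounds(|\mathfrak u|)$, where $\pounds:\{0,1,2,\ldots\}\to(0,\infty)$ is a given non-decreasing function. (A6) For each $\mathfrak u$ there is a sequence of quadrature rules $\{A_{\mathfrak u,n}\}_{n\in\mathbb N\cup\{0\}}$, $A_{\mathfrak u,n}(f_{\mathfrak u})=\sum_{i=1}^{n}w_{\mathfrak u,i}f_{\mathfrak u}(\boldsymbol x_{\mathfrak u,i})$ (weights and points may depend on $n$), with $A_{\mathfrak u,0}=0$. There is $q>0$ (independent of $\mathfrak u$) such that for each $\mathfrak u$ there is $G_{\mathfrak u,q}>0$ with $$\|I_{\mathfrak u}-A_{\mathfrak u,n}\|=\sup_{\|f_{\mathfrak u}\|_{F_{\mathfrak u}}\le1}|I_{\mathfrak u}(f_{\mathfrak u})-A_{\mathfrak u,n}(f_{\mathfrak u})|\le\frac{G_{\mathfrak u,q}}{(n+1)^q},\qquad n=0,1,2,\ldots$$ *)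

theory Defs
  imports "HOL-Probability.Probability"
begin

type_synonym point = "nat \<Rightarrow> real"

section \<open>Product domains, measures and integrals\<close>

text \<open>Points of the domain indexed by \<open>u\<close> are functions that are \<open>undefined\<close> off \<open>u\<close>; the
  domain belonging to the empty set is thus a singleton. The full sequence space is the case
  \<open>u = {1..}\<close>.\<close>

definition dom_prod :: "real set \<Rightarrow> nat set \<Rightarrow> point set" where
  "dom_prod D u = PiE u (\<lambda>_. D)"

text \<open>Lebesgue measure on the product domain (finite \<open>u\<close>), with the Lebesgue (completed)
  sigma-algebra.\<close>

definition leb_prod :: "real set \<Rightarrow> nat set \<Rightarrow> point measure" where
  "leb_prod D u = restrict_space (completion (PiM u (\<lambda>_. lborel))) (dom_prod D u)"

definition mu1 :: "real set \<Rightarrow> (real \<Rightarrow> real) \<Rightarrow> real measure" where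
  "mu1 D \<rho> = density (lebesgue_on D) (\<lambda>x. ennreal (\<rho> x))"

text \<open>The countable product is completed: the integrands are built from functions that are only
  Lebesgue measurable on the finite-dimensional domains.\<close>

definition mu :: "real set \<Rightarrow> (real \<Rightarrow> real) \<Rightarrow> point measure" where
  "mu D \<rho> = completion (PiM {1..} (\<lambda>_. mu1 D \<rho>))"

definition rho_prod :: "(real \<Rightarrow> real) \<Rightarrow> nat set \<Rightarrow> point \<Rightarrow> real" where
  "rho_prod \<rho> u x = (\<Prod>j\<in>u. \<rho> (x j))"

definition Int_u :: "real set \<Rightarrow> (real \<Rightarrow> real) \<Rightarrow> nat set \<Rightarrow> (point \<Rightarrow> real) \<Rightarrow> real" where
  "Int_u D \<rho> u f = (\<integral>x. f x * rho_prod \<rho> u x \<partial>leb_prod D u)"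

definition Int_inf :: "real set \<Rightarrow> (real \<Rightarrow> real) \<Rightarrow> (point \<Rightarrow> real) \<Rightarrow> real" where
  "Int_inf D \<rho> f = (\<integral>x. f x \<partial>mu D \<rho>)"


section \<open>Sums over the finite sets of indices, dominated convergence\<close>

definition fin_summable :: "(nat set \<Rightarrow> real) \<Rightarrow> bool" where
  "fin_summable a \<longleftrightarrow> convergent (\<lambda>d. \<Sum>u\<in>Pow {1..d}. a u)"

definition fin_sum :: "(nat set \<Rightarrow> real) \<Rightarrow> real" where
  "fin_sum a = lim (\<lambda>d. \<Sum>u\<in>Pow {1..d}. a u)"

definition converges_dominantly ::
    "'a measure \<Rightarrow> (nat \<Rightarrow> 'a \<Rightarrow> real) \<Rightarrow> ('a \<Rightarrow> real) \<Rightarrow> bool" where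
  "converges_dominantly M F f \<longleftrightarrow>
     (\<forall>d. integrable M (F d)) \<and>
     (AE x in M. (\<lambda>d. F d x) \<longlonglongrightarrow> f x) \<and>
     (\<exists>g. integrable M g \<and> (\<forall>d. AE x in M. \<bar>F d x\<bar> \<le> \<bar>g x\<bar>))"

definition trunc :: "(nat set \<Rightarrow> point \<Rightarrow> real) \<Rightarrow> nat \<Rightarrow> point \<Rightarrow> real" where
  "trunc c d x = (\<Sum>u\<in>Pow {1..d}. c u (restrict x u))"


section \<open>Normed spaces of functions\<close>

text \<open>\<open>F\<close> is a linear space of real functions on \<open>X\<close> (extended by \<open>undefined\<close> off \<open>X\<close>, so that
  HOL equality is equality on \<open>X\<close>) and \<open>N\<close> is a norm on it; \<open>N\<close> is unconstrained off \<open>F\<close>.\<close>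

definition normed_fun_space ::
    "'a set \<Rightarrow> ('a \<Rightarrow> real) set \<Rightarrow> (('a \<Rightarrow> real) \<Rightarrow> real) \<Rightarrow> bool" where
  "normed_fun_space X F N \<longleftrightarrow>
     F \<subseteq> extensional X \<and>
     (\<lambda>x\<in>X. 0) \<in> F \<and>
     (\<forall>f\<in>F. \<forall>g\<in>F. (\<lambda>x\<in>X. f x + g x) \<in> F) \<and>
     (\<forall>c. \<forall>f\<in>F. (\<lambda>x\<in>X. c * f x) \<in> F) \<and>
     (\<forall>f\<in>F. 0 \<le> N f) \<and>
     (\<forall>f\<in>F. N f = 0 \<longleftrightarrow> f = (\<lambda>x\<in>X. 0)) \<and>
     (\<forall>f\<in>F. \<forall>g\<in>F. N (\<lambda>x\<in>X. f x + g x) \<le> N f + N g) \<and>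
     (\<forall>c. \<forall>f\<in>F. N (\<lambda>x\<in>X. c * f x) = \<bar>c\<bar> * N f)"

text \<open>The metric of the norm; it is set to 0 off \<open>F\<close> because the locale \<open>Metric_space\<close> demands
  nonnegativity and symmetry for all arguments.\<close>

definition norm_dist ::
    "'a set \<Rightarrow> ('a \<Rightarrow> real) set \<Rightarrow> (('a \<Rightarrow> real) \<Rightarrow> real) \<Rightarrow> ('a \<Rightarrow> real) \<Rightarrow> ('a \<Rightarrow> real) \<Rightarrow> real" where
  "norm_dist X F N f g = (if f \<in> F \<and> g \<in> F then N (\<lambda>x\<in>X. f x - g x) else 0)"

definition continuous_functional ::
    "'a set \<Rightarrow> ('a \<Rightarrow> real) set \<Rightarrow> (('a \<Rightarrow> real) \<Rightarrow> real) \<Rightarrow> (('a \<Rightarrow> real) \<Rightarrow> real) \<Rightarrow> bool" where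
  "continuous_functional X F N T \<longleftrightarrow>
     continuous_map (Metric_space.mtopology F (norm_dist X F N)) euclideanreal T"

text \<open>The operator norm is taken in \<open>ennreal\<close>, so an unbounded functional has norm \<open>\<top>\<close>.\<close>

definition functional_norm ::
    "('a \<Rightarrow> real) set \<Rightarrow> (('a \<Rightarrow> real) \<Rightarrow> real) \<Rightarrow> (('a \<Rightarrow> real) \<Rightarrow> real) \<Rightarrow> ennreal" where
  "functional_norm F N T = (SUP f\<in>{f \<in> F. N f \<le> 1}. ennreal \<bar>T f\<bar>)"


section \<open>Quadrature rules\<close>

text \<open>\<open>w n i\<close> and \<open>p n i\<close> (\<open>1 \<le> i \<le> n\<close>) are the weights and points of the rule with \<open>n\<close> nodes.
  For \<open>n = 0\<close> the rule is 0.\<close>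

definition quad ::
    "(nat \<Rightarrow> nat \<Rightarrow> real) \<Rightarrow> (nat \<Rightarrow> nat \<Rightarrow> point) \<Rightarrow> nat \<Rightarrow> (point \<Rightarrow> real) \<Rightarrow> real" where
  "quad w p n f = (\<Sum>i=1..n. w n i * f (p n i))"

definition Max0 :: "('a \<Rightarrow> real) \<Rightarrow> 'a set \<Rightarrow> real" where
  "Max0 f S = (if S = {} then 0 else Max (f ` S))"

end

theory Submission
  imports Defs
begin

text \<open>The idea. By dominated convergence, the integral of \<open>f\<close> is the limit of the integrals of its
  truncations, and the integral of a truncation is the finite sum of the numbers \<open>I\<^sub>u(f\<^sub>u)\<close>. So
  the error of the algorithm splits, at each truncation level that contains the active set \<open>U\<close>, into
  two parts, and each is at most \<open>\<epsilon>/2\<close>, uniformly in the level.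

  \<^item> The integrals ignored by the algorithm. Each is at most \<open>a\<^sub>u = C\<^sub>u B\<^sub>u\<close>, and
    \<open>a\<^sub>u = a\<^sub>u\<^bsup>1-1/\<alpha>\<^esup> a\<^sub>u\<^bsup>1/\<alpha>\<^esup>\<close>. Off \<open>U\<close> the first factor is at most \<open>\<epsilon>/2\<close> divided by the sum of
    all the second factors, whence the bound (\<open>sum_outside_active_set\<close>). The sum of the second factors
    converges since \<open>\<alpha> < \<alpha>\<^sub>0\<close> (\<open>fin_summable_powr_mono\<close>), and for the same reason only
    finitely many sets are active (\<open>finite_active_set\<close>).

  \<^item> The quadrature errors on \<open>U\<close>. They are at most \<open>G\<^sub>u B\<^sub>u / (n\<^sub>u + 1)\<^bsup>q\<^esup>\<close>, hence at most
    \<open>G\<^sub>u B\<^sub>u / h\<^sub>u\<^bsup>q\<^esup>\<close>. The real numbers \<open>h\<^sub>u\<close> solve the problem of minimising the cost under the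
    constraint that these bounds add up to \<open>\<epsilon>/2\<close>: by the choice of \<open>h\<close>, the cost and the error
    bound of the set \<open>u\<close> are both proportional to \<open>\<kappa>\<^sub>u = c\<^sub>u\<^bsup>q/(q+1)\<^esup> (G\<^sub>u B\<^sub>u)\<^bsup>1/(q+1)\<^esup>\<close>, where
    \<open>c\<^sub>u\<close> is the cost of one evaluation. Summing over \<open>u\<close> gives the error bound (\<open>allocation_error\<close>)
    and the cost (\<open>allocation_cost\<close>); bounding every \<open>c\<^sub>u\<close> by the maximum gives the last estimate
    (\<open>allocation_cost_Max\<close>).

  Most of the work is measure theoretic: the integral of a function of finitely many variables with
  respect to the infinite product measure has to be identified with the weighted Lebesgue integral
  over the finite-dimensional domain (\<open>cylinder_integral\<close>). The functions are only Lebesgue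
  measurable, so they do not compose well with projections. They and the density \<open>\<rho>\<close> are therefore
  replaced by Borel functions that agree with them almost everywhere, and the null sets are carried
  along the marginals of the product measure.\<close>

section \<open>Completed measures and null sets\<close>

text \<open>In a complete space, measurability survives changes on null sets. This gives the measurability of
  functions known only almost everywhere, such as the limit in dominated convergence.\<close>

lemma (in complete_measure) borel_measurable_AE_eq:
  fixes f g :: "'a \<Rightarrow> real"
  assumes g: "g \<in> borel_measurable M" and eq: "AE x in M. f x = g x"
  shows "f \<in> borel_measurable M"
proof (rule measurableI)
  fix S :: "real set" assume S: "S \<in> sets borel"
  have "AE x in M. x \<in> g -` S \<inter> space M \<longleftrightarrow> x \<in> f -` S \<inter> space M"
    using eq by eventually_elim auto
  then show "f -` S \<inter> space M \<in> sets M"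
    by (rule in_sets_AE) (use g S in \<open>auto intro: measurable_sets\<close>)
qed simp

text \<open>The exceptional set is contained in a box with one side of measure 0. Its measure vanishes even if
  the other sides have infinite measure, as happens for \<open>lborel\<close>.\<close>

lemma AE_PiM_component_sigma_finite:
  assumes M: "product_sigma_finite M" and u: "finite u" "j \<in> u" and P: "AE y in M j. P y"
  shows "AE x in PiM u M. P (x j)"
proof -
  interpret product_sigma_finite M by (rule M)
  from P obtain N where N: "{y \<in> space (M j). \<not> P y} \<subseteq> N" "emeasure (M j) N = 0" "N \<in> sets (M j)"
    by (rule AE_E)
  let ?E = "\<lambda>i. if i = j then N else space (M i)"
  have "emeasure (PiM u M) (PiE u ?E) = (\<Prod>i\<in>u. emeasure (M i) (?E i))"
    using u N by (intro emeasure_PiM) auto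
  also have "\<dots> = 0"
    using u N by (auto simp: prod_zero_iff intro!: bexI[of _ j])
  finally have "PiE u ?E \<in> null_sets (PiM u M)"
    using u N by (auto simp: null_sets_def intro!: sets_PiM_I_finite)
  moreover have "{x \<in> space (PiM u M). \<not> P (x j)} \<subseteq> PiE u ?E"
  proof
    fix x assume x: "x \<in> {x \<in> space (PiM u M). \<not> P (x j)}"
    then have "x \<in> PiE u (\<lambda>i. space (M i))" by (simp add: space_PiM)
    moreover have "x j \<in> N" using x N(1) u PiE_mem[OF calculation u(2)] by blast
    ultimately show "x \<in> PiE u ?E" by (simp add: PiE_iff)
  qed
  ultimately show ?thesis by (rule AE_I')
qed

section \<open>Finite-dimensional marginals of the product measure\<close>

text \<open>A Borel version of \<open>\<rho>\<close>, extended by 0 off \<open>D\<close>. It makes \<open>mu1 D \<rho>\<close> a measure on the Borel sets of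
  the whole line, where the theory of finite products of \<open>lborel\<close> applies.\<close>

lemma borel_density_version:
  assumes D: "D \<in> sets borel" and rho: "\<rho> \<in> borel_measurable (lebesgue_on D)"
    and nonneg: "\<And>x. x \<in> D \<Longrightarrow> 0 \<le> \<rho> x"
  obtains r :: "real \<Rightarrow> real" where "r \<in> borel_measurable borel" "\<And>x. 0 \<le> r x"
    "AE x in lborel. indicator D x * \<rho> x = r x"
proof -
  have "(\<lambda>x. indicator D x *\<^sub>R \<rho> x) \<in> borel_measurable lebesgue"
    using D rho by (subst borel_measurable_restrict_space_iff[symmetric]) auto
  from completion_ex_borel_measurable_real[OF this[simplified]] obtain s
    where s: "s \<in> borel_measurable lborel" "AE x in lborel. indicator D x * \<rho> x = s x" by auto
  show thesis
  proof (rule that[of "\<lambda>x. max 0 (s x)"])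
    show "(\<lambda>x. max 0 (s x)) \<in> borel_measurable borel" using s(1) by simp
    show "AE x in lborel. indicator D x * \<rho> x = max 0 (s x)"
      using s(2)
    proof eventually_elim
      case (elim x)
      have "0 \<le> indicator D x * \<rho> x" using nonneg[of x] by (auto simp: indicator_def)
      then show ?case using elim by simp
    qed
  qed simp
qed

lemma emeasure_mu1_Int:
  assumes D: "D \<in> sets borel" and rho: "\<rho> \<in> borel_measurable (lebesgue_on D)"
    and r: "r \<in> borel_measurable borel"
    and eq: "AE x in lborel. indicator D x * \<rho> x = r x" and E: "E \<in> sets borel"
  shows "emeasure (mu1 D \<rho>) (E \<inter> D) = emeasure (density lborel (\<lambda>x. ennreal (r x))) E"
proof -
  have ED: "E \<inter> D \<in> sets (lebesgue_on D)"
    using D E by (simp add: sets_restrict_space_iff)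
  have "emeasure (mu1 D \<rho>) (E \<inter> D) = (\<integral>\<^sup>+x. ennreal (\<rho> x) * indicator (E \<inter> D) x \<partial>lebesgue_on D)"
    unfolding mu1_def using rho ED by (subst emeasure_density) auto
  also have "\<dots> = (\<integral>\<^sup>+x. ennreal (\<rho> x) * indicator (E \<inter> D) x * indicator D x \<partial>lebesgue)"
    using D by (subst nn_integral_restrict_space) auto
  also have "\<dots> = (\<integral>\<^sup>+x. ennreal (r x) * indicator E x \<partial>lebesgue)"
    using AE_completion[OF eq] by (intro nn_integral_cong_AE) (auto elim!: eventually_mono simp: indicator_def)
  also have "\<dots> = (\<integral>\<^sup>+x. ennreal (r x) * indicator E x \<partial>lborel)"
    by (rule nn_integral_completion)
  also have "\<dots> = emeasure (density lborel (\<lambda>x. ennreal (r x))) E"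
    using r E by (subst emeasure_density) auto
  finally show ?thesis .
qed

lemma measurable_restrict_PiM_mu1:
  assumes D: "D \<in> sets borel" and u: "u \<subseteq> I"
  shows "(\<lambda>x. restrict x u) \<in> PiM I (\<lambda>_. mu1 D \<rho>) \<rightarrow>\<^sub>M PiM u (\<lambda>_. lborel)"
proof (rule measurable_restrict)
  fix i assume i: "i \<in> u"
  have "(\<lambda>y. y) \<in> mu1 D \<rho> \<rightarrow>\<^sub>M lborel"
    using D by (intro measurableI) (auto simp: mu1_def space_restrict_space sets_restrict_space_iff)
  then show "(\<lambda>x. x i) \<in> PiM I (\<lambda>_. mu1 D \<rho>) \<rightarrow>\<^sub>M lborel"
    using i u by (intro measurable_compose[OF measurable_component_singleton]) auto
qed

text \<open>Both sides are finite products of the measure with density \<open>r\<close>, because they agree with that product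
  on boxes. On the left this is the defining property of the infinite product, on the right Fubini's
  theorem for products of functions of one variable.\<close>

lemma distr_restrict_PiM_mu1:
  fixes u I :: "'i set"
  assumes D: "D \<in> sets borel" and rho: "\<rho> \<in> borel_measurable (lebesgue_on D)"
    and prob: "prob_space (mu1 D \<rho>)"
    and r: "r \<in> borel_measurable borel" "\<And>x. 0 \<le> r x"
    and eq: "AE x in lborel. indicator D x * \<rho> x = r x"
    and u: "finite u" "u \<subseteq> I"
  shows "distr (PiM I (\<lambda>_. mu1 D \<rho>)) (PiM u (\<lambda>_. lborel)) (\<lambda>x. restrict x u)
    = density (PiM u (\<lambda>_. lborel)) (\<lambda>x. ennreal (\<Prod>j\<in>u. r (x j)))"
proof -
  define m where "m = density lborel (\<lambda>x. ennreal (r x))"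
  have sm: "sets m = sets borel" by (simp add: m_def)
  have sp1: "space (mu1 D \<rho>) = D" by (simp add: mu1_def space_restrict_space)
  have setsB: "E \<inter> D \<in> sets (mu1 D \<rho>)" if "E \<in> sets borel" for E
    using that D by (simp add: mu1_def sets_restrict_space_iff)
  have mE: "emeasure (mu1 D \<rho>) (E \<inter> D) = emeasure m E" if "E \<in> sets borel" for E
    unfolding m_def using emeasure_mu1_Int[OF D rho r(1) eq that] .
  interpret P1: prob_space "mu1 D \<rho>" by (rule prob)
  have "emeasure m (space m) = 1"
    using mE[of UNIV] P1.emeasure_space_1 by (simp add: sp1 m_def)
  then interpret m: prob_space m by (rule prob_spaceI)
  interpret pm: product_sigma_finite "\<lambda>_::'i. m" ..
  interpret pl: product_sigma_finite "\<lambda>_::'i. lborel :: real measure" ..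
  have sPm: "sets (PiM u (\<lambda>_. m)) = sets (PiM u (\<lambda>_. lborel))"
    by (intro sets_PiM_cong) (auto simp: sm)
  note meas = measurable_restrict_PiM_mu1[OF D u(2), of \<rho>]
  have "distr (PiM I (\<lambda>_. mu1 D \<rho>)) (PiM u (\<lambda>_. lborel)) (\<lambda>x. restrict x u) = PiM u (\<lambda>_. m)"
  proof (rule pm.PiM_eqI)
    fix E assume E: "\<And>i. i \<in> u \<Longrightarrow> E i \<in> sets m"
    have vi: "(\<lambda>x. restrict x u) -` PiE u E \<inter> space (PiM I (\<lambda>_. mu1 D \<rho>)) =
        prod_emb I (\<lambda>_. mu1 D \<rho>) u (PiE u (\<lambda>i. E i \<inter> D))"
      using u by (auto simp: space_PiM prod_emb_def PiE_iff sp1 subset_iff)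
    have "emeasure (distr (PiM I (\<lambda>_. mu1 D \<rho>)) (PiM u (\<lambda>_. lborel)) (\<lambda>x. restrict x u)) (PiE u E)
       = emeasure (PiM I (\<lambda>_. mu1 D \<rho>)) (prod_emb I (\<lambda>_. mu1 D \<rho>) u (PiE u (\<lambda>i. E i \<inter> D)))"
      using E u by (subst emeasure_distr[OF meas]) (auto simp: vi sm intro!: sets_PiM_I_finite)
    also have "\<dots> = (\<Prod>i\<in>u. emeasure (mu1 D \<rho>) (E i \<inter> D))"
      using E u prob setsB by (intro emeasure_PiM_emb) (auto simp: sm)
    also have "\<dots> = (\<Prod>i\<in>u. emeasure m (E i))"
      using E by (intro prod.cong) (auto simp: mE sm)
    finally show "emeasure (distr (PiM I (\<lambda>_. mu1 D \<rho>)) (PiM u (\<lambda>_. lborel)) (\<lambda>x. restrict x u)) (PiE u E)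
       = (\<Prod>i\<in>u. emeasure m (E i))" .
  qed (use u sPm in auto)
  moreover have "density (PiM u (\<lambda>_. lborel)) (\<lambda>x. ennreal (\<Prod>j\<in>u. r (x j))) = PiM u (\<lambda>_. m)"
  proof (rule pm.PiM_eqI)
    fix E assume E: "\<And>i. i \<in> u \<Longrightarrow> E i \<in> sets m"
    have rm: "(\<lambda>x. ennreal (\<Prod>j\<in>u. r (x j))) \<in> borel_measurable (PiM u (\<lambda>_. lborel))"
      using r(1) by measurable
    have "emeasure (density (PiM u (\<lambda>_. lborel)) (\<lambda>x. ennreal (\<Prod>j\<in>u. r (x j)))) (PiE u E)
       = (\<integral>\<^sup>+x. ennreal (\<Prod>j\<in>u. r (x j)) * indicator (PiE u E) x \<partial>PiM u (\<lambda>_. lborel))"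
      using E u rm by (subst emeasure_density) (auto simp: sm intro!: sets_PiM_I_finite)
    also have "\<dots> = (\<integral>\<^sup>+x. (\<Prod>j\<in>u. ennreal (r (x j)) * indicator (E j) (x j)) \<partial>PiM u (\<lambda>_. lborel))"
    proof (rule nn_integral_cong)
      fix x assume x: "x \<in> space (PiM u (\<lambda>_::'i. lborel :: real measure))"
      have "indicator (PiE u E) x = (\<Prod>j\<in>u. indicator (E j) (x j) :: ennreal)"
        using x u by (auto simp: space_PiM PiE_iff indicator_def)
      then show "ennreal (\<Prod>j\<in>u. r (x j)) * indicator (PiE u E) x
        = (\<Prod>j\<in>u. ennreal (r (x j)) * indicator (E j) (x j))"
        using r(2) by (simp add: prod.distrib prod_ennreal)
    qed
    also have "\<dots> = (\<Prod>j\<in>u. \<integral>\<^sup>+y. ennreal (r y) * indicator (E j) y \<partial>lborel)"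
      using E u r(1) by (intro pl.product_nn_integral_prod) (auto simp: sm)
    also have "\<dots> = (\<Prod>i\<in>u. emeasure m (E i))"
      using E r(1) by (intro prod.cong) (auto simp: m_def emeasure_density)
    finally show "emeasure (density (PiM u (\<lambda>_. lborel)) (\<lambda>x. ennreal (\<Prod>j\<in>u. r (x j)))) (PiE u E)
       = (\<Prod>i\<in>u. emeasure m (E i))" .
  qed (use u sPm in auto)
  ultimately show ?thesis by simp
qed

section \<open>Integrals over the sequence space\<close>

text \<open>The variables outside \<open>u\<close> integrate to 1. The proof replaces \<open>g\<close> and \<open>\<rho>\<close> by Borel versions \<open>g'\<close> and
  \<open>r\<close>, for which the claim is the change of variables along the projection to the coordinates in \<open>u\<close>.
  A set that is null for Lebesgue measure is null for the marginal, which has a density, and its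
  preimage is null in the sequence space; so the replacement changes neither side.\<close>

lemma cylinder_integral:
  assumes D: "D \<in> sets borel" and rho: "\<rho> \<in> borel_measurable (lebesgue_on D)"
    and nonneg: "\<And>x. x \<in> D \<Longrightarrow> 0 \<le> \<rho> x" and prob: "prob_space (mu1 D \<rho>)"
    and u: "finite u" "u \<subseteq> {1..}"
    and g: "g \<in> borel_measurable (leb_prod D u)"
    and int: "integrable (leb_prod D u) (\<lambda>x. g x * rho_prod \<rho> u x)"
  shows "integrable (mu D \<rho>) (\<lambda>x. g (restrict x u))"
    and "Int_inf D \<rho> (\<lambda>x. g (restrict x u)) = Int_u D \<rho> u g"
proof -
  define L where "L = PiM u (\<lambda>_. lborel :: real measure)"
  define P where "P = PiM {1..} (\<lambda>_::nat. mu1 D \<rho>)"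
  define X where "X = dom_prod D u"
  have lp: "leb_prod D u = restrict_space (completion L) X"
    by (simp add: leb_prod_def L_def X_def)
  have XL: "X \<in> sets L"
    unfolding X_def dom_prod_def L_def using D u by (intro sets_PiM_I_finite) auto
  then have Xc: "X \<inter> space (completion L) \<in> sets (completion L)" by auto
  obtain r where r: "r \<in> borel_measurable borel" "\<And>x. 0 \<le> r x"
    and r_eq: "AE x in lborel. indicator D x * \<rho> x = r x"
    using borel_density_version[OF D rho nonneg] by blast
  define R where "R x = (\<Prod>j\<in>u. r (x j))" for x
  have R: "R \<in> borel_measurable L" "\<And>x. 0 \<le> R x"
    using r by (auto simp: R_def[abs_def] L_def intro!: prod_nonneg)
  have "(\<lambda>x. indicator X x * g x) \<in> borel_measurable (completion L)"
    using g unfolding lp borel_measurable_restrict_space_iff[OF Xc] by simp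
  from completion_ex_borel_measurable_real[OF this] obtain g'
    where g': "g' \<in> borel_measurable L" "AE x in L. indicator X x * g x = g' x" by auto
  have "AE x in L. \<forall>j\<in>u. indicator D (x j) * \<rho> (x j) = r (x j)"
    unfolding L_def using u r_eq
    by (intro AE_finite_allI AE_PiM_component_sigma_finite[where M="\<lambda>_. lborel"])
       (auto simp: product_sigma_finite_def lborel.sigma_finite_measure_axioms)
  then have rhoX: "AE x in L. indicator X x * rho_prod \<rho> u x = R x"
    using AE_space
  proof eventually_elim
    case (elim x)
    have "indicator X x = (\<Prod>j\<in>u. indicator D (x j) :: real)"
      using elim(2) u by (auto simp: X_def dom_prod_def L_def space_PiM PiE_iff indicator_def)
    then show ?case
      using elim(1) by (simp add: rho_prod_def R_def prod.distrib[symmetric])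
  qed
  \<comment> \<open>The single indicator on the left serves both factors because it is idempotent.\<close>
  have eq: "AE x in completion L. indicator X x *\<^sub>R (g x * rho_prod \<rho> u x) = R x * g' x"
    using AE_completion[OF g'(2)] AE_completion[OF rhoX]
    by eventually_elim (auto simp: indicator_def split: if_splits)
  have Rg: "(\<lambda>x. R x * g' x) \<in> borel_measurable L"
    using R g' by auto
  have intX: "integrable (completion L) (\<lambda>x. indicator X x *\<^sub>R (g x * rho_prod \<rho> u x))"
    using int unfolding lp integrable_restrict_space[OF Xc] .
  have i1: "integrable L (\<lambda>x. R x * g' x)"
    using intX integrable_cong_AE[OF borel_measurable_integrable[OF intX] measurable_completion[OF Rg] eq]
    by (simp add: integrable_completion[OF Rg])
  have "Int_u D \<rho> u g = (\<integral>x. indicator X x *\<^sub>R (g x * rho_prod \<rho> u x) \<partial>completion L)"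
    unfolding Int_u_def lp by (rule integral_restrict_space[OF Xc])
  also have "\<dots> = (\<integral>x. R x * g' x \<partial>completion L)"
    by (rule integral_cong_AE[OF borel_measurable_integrable[OF intX] measurable_completion[OF Rg] eq])
  also have "\<dots> = (\<integral>x. R x * g' x \<partial>L)"
    by (rule integral_completion[OF Rg])
  also have "\<dots> = integral\<^sup>L (density L R) g'"
    using g' R by (subst integral_density) auto
  finally have I1: "Int_u D \<rho> u g = integral\<^sup>L (density L R) g'" .
  have i2: "integrable (density L R) g'"
    using i1 g' R by (subst integrable_density) auto
  have dd: "distr P L (\<lambda>x. restrict x u) = density L R"
    unfolding P_def L_def R_def[abs_def] by (rule distr_restrict_PiM_mu1[OF D rho prob r r_eq u])
  have meas: "(\<lambda>x. restrict x u) \<in> P \<rightarrow>\<^sub>M L"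
    unfolding P_def L_def by (rule measurable_restrict_PiM_mu1[OF D u(2)])
  have "AE x in density L R. indicator X x * g x = g' x"
    using g'(2) R(1) by (subst AE_density) auto
  then have "AE x in P. indicator X (restrict x u) * g (restrict x u) = g' (restrict x u)"
    unfolding dd[symmetric] by (rule AE_distrD[OF meas])
  then have aeP: "AE x in P. g (restrict x u) = g' (restrict x u)"
    using AE_space
  proof eventually_elim
    case (elim x)
    have "restrict x u \<in> X"
      using elim(2) u by (auto simp: P_def space_PiM mu1_def space_restrict_space X_def dom_prod_def PiE_iff)
    then show ?case using elim(1) by simp
  qed
  have g'P: "(\<lambda>x. g' (restrict x u)) \<in> borel_measurable P"
    using measurable_compose[OF meas g'(1)] .
  have gP: "(\<lambda>x. g (restrict x u)) \<in> borel_measurable (completion P)"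
    by (rule completion.borel_measurable_AE_eq[OF measurable_completion[OF g'P] AE_completion[OF aeP]])
  have i3: "integrable P (\<lambda>x. g' (restrict x u))"
    using i2 integrable_distr_eq[OF meas g'(1)] by (simp add: dd)
  have mu: "mu D \<rho> = completion P" by (simp add: mu_def P_def)
  show "integrable (mu D \<rho>) (\<lambda>x. g (restrict x u))"
    using i3 integrable_cong_AE[OF gP measurable_completion[OF g'P] AE_completion[OF aeP]]
    by (simp add: mu integrable_completion[OF g'P])
  have "Int_inf D \<rho> (\<lambda>x. g (restrict x u)) = (\<integral>x. g' (restrict x u) \<partial>P)"
    unfolding Int_inf_def mu
    using integral_cong_AE[OF gP measurable_completion[OF g'P] AE_completion[OF aeP]]
    by (simp add: integral_completion[OF g'P])
  also have "\<dots> = Int_u D \<rho> u g"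
    using integral_distr[OF meas g'(1)] by (simp add: dd I1)
  finally show "Int_inf D \<rho> (\<lambda>x. g (restrict x u)) = Int_u D \<rho> u g" .
qed

text \<open>The limit \<open>f\<close> is not assumed measurable. It agrees almost everywhere with a pointwise limit of
  measurable functions, and \<open>mu D \<rho>\<close> is complete.\<close>

lemma Int_inf_dominated_limit:
  assumes dom: "converges_dominantly (mu D \<rho>) F f"
  shows "(\<lambda>d. Int_inf D \<rho> (F d)) \<longlonglongrightarrow> Int_inf D \<rho> f"
proof -
  from dom obtain g where F: "\<And>d. integrable (mu D \<rho>) (F d)"
    and lim: "AE x in mu D \<rho>. (\<lambda>d. F d x) \<longlonglongrightarrow> f x"
    and g: "integrable (mu D \<rho>) g" "\<And>d. AE x in mu D \<rho>. \<bar>F d x\<bar> \<le> \<bar>g x\<bar>"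
    unfolding converges_dominantly_def by blast
  have Fm: "F d \<in> borel_measurable (mu D \<rho>)" for d
    by (rule borel_measurable_integrable[OF F])
  let ?l = "\<lambda>x. lim (\<lambda>d. F d x)"
  have "?l \<in> borel_measurable (mu D \<rho>)"
    using Fm by (rule borel_measurable_lim_metric)
  moreover have "AE x in mu D \<rho>. f x = ?l x"
    using lim by eventually_elim (simp add: limI)
  ultimately have "f \<in> borel_measurable (mu D \<rho>)"
    unfolding mu_def by (rule completion.borel_measurable_AE_eq)
  then show ?thesis
    unfolding Int_inf_def using Fm g lim
    by (intro integral_dominated_convergence[where w="\<lambda>x. \<bar>g x\<bar>"]) auto
qed

lemma Int_inf_trunc:
  assumes "\<And>u. u \<in> Pow {1..d} \<Longrightarrow> integrable (mu D \<rho>) (\<lambda>x. c u (restrict x u))"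
    and "\<And>u. u \<in> Pow {1..d} \<Longrightarrow> Int_inf D \<rho> (\<lambda>x. c u (restrict x u)) = Int_u D \<rho> u (c u)"
  shows "Int_inf D \<rho> (trunc c d) = (\<Sum>u\<in>Pow {1..d}. Int_u D \<rho> u (c u))"
proof -
  have "Int_inf D \<rho> (trunc c d) = (\<Sum>u\<in>Pow {1..d}. Int_inf D \<rho> (\<lambda>x. c u (restrict x u)))"
    unfolding Int_inf_def trunc_def using assms(1) by (rule Bochner_Integration.integral_sum)
  also have "\<dots> = (\<Sum>u\<in>Pow {1..d}. Int_u D \<rho> u (c u))"
    using assms(2) by (rule sum.cong[OF refl])
  finally show ?thesis .
qed

section \<open>Functionals bounded by their norm\<close>

text \<open>Rescaling \<open>f\<close> to norm 1 reduces the claim to the definition of the norm; for \<open>N f = 0\<close> definiteness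
  makes \<open>f\<close> the zero function, and homogeneity makes \<open>T f\<close> vanish.\<close>

lemma functional_norm_bound:
  assumes X: "normed_fun_space X F N"
    and hom: "\<And>c f. f \<in> F \<Longrightarrow> T (\<lambda>x\<in>X. c * f x) = c * T f"
    and le: "functional_norm F N T \<le> ennreal r" and r: "0 \<le> r" and f: "f \<in> F"
  shows "\<bar>T f\<bar> \<le> r * N f"
proof (cases "N f = 0")
  case True
  then have "f = (\<lambda>x\<in>X. 0 * f x)"
    using X f by (simp add: normed_fun_space_def)
  then have "T f = 0" using hom[OF f, of 0] by simp
  then show ?thesis using True by simp
next
  case False
  then have pos: "0 < N f"
    using X f by (auto simp: normed_fun_space_def less_le)
  let ?g = "\<lambda>x\<in>X. (1 / N f) * f x"
  have "?g \<in> F" "N ?g = \<bar>1 / N f\<bar> * N f"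
    using X f unfolding normed_fun_space_def by blast+
  then have "?g \<in> {f \<in> F. N f \<le> 1}" using pos by simp
  then have "ennreal \<bar>T ?g\<bar> \<le> functional_norm F N T"
    unfolding functional_norm_def by (rule SUP_upper)
  then have "ennreal \<bar>T ?g\<bar> \<le> ennreal r" using le by (rule order_trans)
  then have "\<bar>T ?g\<bar> \<le> r" using r by simp
  also have "T ?g = 1 / N f * T f" by (rule hom[OF f])
  finally show ?thesis using pos by (simp add: abs_mult divide_simps)
qed

lemma Int_u_scale: "Int_u D \<rho> u (\<lambda>x\<in>dom_prod D u. c * g x) = c * Int_u D \<rho> u g"
proof -
  have "Int_u D \<rho> u (\<lambda>x\<in>dom_prod D u. c * g x)
      = (\<integral>x. c * (g x * rho_prod \<rho> u x) \<partial>leb_prod D u)"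
    unfolding Int_u_def
    by (intro Bochner_Integration.integral_cong) (auto simp: leb_prod_def space_restrict_space)
  then show ?thesis by (simp add: Int_u_def)
qed

lemma quad_scale:
  assumes "\<And>i. i \<in> {1..m} \<Longrightarrow> p m i \<in> X"
  shows "quad w p m (\<lambda>x\<in>X. c * g x) = c * quad w p m g"
  unfolding quad_def sum_distrib_left
proof (rule sum.cong)
  fix i assume "i \<in> {1..m}"
  then show "w m i * (\<lambda>x\<in>X. c * g x) (p m i) = c * (w m i * g (p m i))"
    using assms[of i] by simp
qed simp

section \<open>Sums over the finite sets of indices\<close>

text \<open>Every finite family of index sets is eventually covered by the partial sums. With nonnegative terms
  this makes \<open>fin_sum\<close> the supremum of the finite sums, so it behaves like an unordered sum.\<close>

lemma finite_family_bounded: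
  assumes "finite V" "V \<subseteq> Fpow {1..}"
  shows "\<exists>d0. \<forall>d\<ge>d0. V \<subseteq> Pow {1..d::nat}"
proof (intro exI allI impI)
  fix d assume d: "Max (insert 0 (\<Union>V)) \<le> d"
  have fin: "finite (insert 0 (\<Union>V))" using assms by (auto simp: Fpow_def)
  show "V \<subseteq> Pow {1..d}"
  proof safe
    fix u j assume uj: "u \<in> V" "j \<in> u"
    then have "j \<le> Max (insert 0 (\<Union>V))" using fin by (intro Max_ge) auto
    then show "j \<in> {1..d}" using uj d assms by (auto simp: Fpow_def)
  qed
qed

lemma Pow_subset_Fpow: "Pow {1..d::nat} \<subseteq> Fpow {1..}"
proof
  fix u assume "u \<in> Pow {1..d}"
  then have "u \<subseteq> {1..d}" by simp
  then have "finite u" "u \<subseteq> {1..}" by (auto dest: finite_subset)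
  then show "u \<in> Fpow {1..}" by (simp add: Fpow_def)
qed

lemma incseq_fin_partial_sums:
  assumes "\<And>u. u \<in> Fpow {1..} \<Longrightarrow> 0 \<le> a u"
  shows "incseq (\<lambda>d. \<Sum>u\<in>Pow {1..d}. a u :: real)"
proof (rule incseq_SucI)
  fix d
  show "(\<Sum>u\<in>Pow {1..d}. a u) \<le> (\<Sum>u\<in>Pow {1..Suc d}. a u)"
  proof (rule sum_mono2)
    fix u assume "u \<in> Pow {1..Suc d} - Pow {1..d}"
    then show "0 \<le> a u" using Pow_subset_Fpow[of "Suc d"] by (intro assms) blast
  qed auto
qed

lemma sum_le_fin_sum:
  assumes nonneg: "\<And>u. u \<in> Fpow {1..} \<Longrightarrow> 0 \<le> a u" and summ: "fin_summable a"
    and V: "finite V" "V \<subseteq> Fpow {1..}"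
  shows "sum a V \<le> fin_sum a"
proof -
  obtain d where d: "V \<subseteq> Pow {1..d}"
    using finite_family_bounded[OF V] by auto
  have "sum a V \<le> (\<Sum>u\<in>Pow {1..d}. a u)"
  proof (rule sum_mono2)
    fix u assume "u \<in> Pow {1..d} - V"
    then show "0 \<le> a u" using Pow_subset_Fpow[of d] by (intro nonneg) blast
  qed (use d in simp_all)
  also have "\<dots> \<le> fin_sum a"
  proof (rule incseq_le[where X="\<lambda>d. \<Sum>u\<in>Pow {1..d}. a u"])
    show "incseq (\<lambda>d. \<Sum>u\<in>Pow {1..d}. a u)"
      using nonneg by (rule incseq_fin_partial_sums)
    show "(\<lambda>d. \<Sum>u\<in>Pow {1..d}. a u) \<longlonglongrightarrow> fin_sum a"
      using summ unfolding fin_summable_def fin_sum_def convergent_LIMSEQ_iff .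
  qed
  finally show ?thesis .
qed

text \<open>Each term \<open>a u powr s\<close> is at most the whole sum \<open>L\<close>, so that
  \<open>a u powr t = a u powr s * (a u powr s) powr (t / s - 1)\<close> is at most a constant times
  \<open>a u powr s\<close>. This is why the sum with exponent \<open>1 / \<alpha>\<close> converges whenever \<open>1 < \<alpha> < \<alpha>\<^sub>0\<close>, although
  the supremum only gives convergence for some exponent \<open>1 / a'\<close> with \<open>\<alpha> < a'\<close>.\<close>

lemma fin_summable_powr_mono:
  assumes st: "0 < s" "s \<le> t" and summ: "fin_summable (\<lambda>u. a u powr s)"
  shows "fin_summable (\<lambda>u. a u powr t)"
proof -
  define L where "L = fin_sum (\<lambda>u. a u powr s)"
  define e where "e = t / s - 1"
  have e: "0 \<le> e" using st by (simp add: e_def)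
  have le: "a u powr t \<le> a u powr s * L powr e" if u: "u \<in> Fpow {1..}" for u
  proof -
    have "a u powr s \<le> L"
      using sum_le_fin_sum[OF _ summ, of "{u}"] u by (simp add: L_def)
    then have "(a u powr s) powr e \<le> L powr e"
      using e by (intro powr_mono2) auto
    moreover have "a u powr t = a u powr s * (a u powr s) powr e"
    proof -
      have "t = s + s * e" using st by (simp add: e_def field_simps)
      then show ?thesis by (simp add: powr_powr flip: powr_add)
    qed
    ultimately show ?thesis by (simp add: mult_left_mono)
  qed
  have bound: "(\<Sum>u\<in>Pow {1..d}. a u powr t) \<le> L * L powr e" for d
  proof -
    have "(\<Sum>u\<in>Pow {1..d}. a u powr t) \<le> (\<Sum>u\<in>Pow {1..d}. a u powr s * L powr e)"
      using Pow_subset_Fpow[of d] by (intro sum_mono le) blast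
    also have "\<dots> = (\<Sum>u\<in>Pow {1..d}. a u powr s) * L powr e"
      by (simp add: sum_distrib_right)
    also have "\<dots> \<le> L * L powr e"
      unfolding L_def using Pow_subset_Fpow[of d]
      by (intro mult_right_mono sum_le_fin_sum[OF _ summ]) auto
    finally show ?thesis .
  qed
  have "incseq (\<lambda>d. \<Sum>u\<in>Pow {1..d}. a u powr t)"
    by (rule incseq_fin_partial_sums) simp
  then obtain l where "(\<lambda>d. \<Sum>u\<in>Pow {1..d}. a u powr t) \<longlonglongrightarrow> l"
    using bound by (rule incseq_convergent[OF _ allI])
  then show ?thesis unfolding fin_summable_def by (rule convergentI)
qed

text \<open>Many terms of size \<open>\<delta>\<close> would exceed the sum.\<close>

lemma finite_above_threshold:
  assumes nonneg: "\<And>u. u \<in> Fpow {1..} \<Longrightarrow> 0 \<le> a u" and summ: "fin_summable a"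
    and \<delta>: "0 < \<delta>"
  shows "finite {u \<in> Fpow {1..}. \<delta> \<le> a u}"
proof (rule ccontr)
  let ?S = "{u \<in> Fpow {1..}. \<delta> \<le> a u}"
  assume inf: "infinite ?S"
  obtain m :: nat where m: "fin_sum a / \<delta> < real m" using reals_Archimedean2 by blast
  obtain V where V: "finite V" "card V = m" "V \<subseteq> ?S"
    using infinite_arbitrarily_large[OF inf] by blast
  have "real m * \<delta> \<le> sum a V"
    using V sum_mono[of V "\<lambda>_. \<delta>" a] by auto
  also have "\<dots> \<le> fin_sum a"
    using V by (intro sum_le_fin_sum[OF nonneg summ]) auto
  finally show False using m \<delta> by (simp add: divide_simps)
qed

text \<open>The threshold on \<open>a u powr (1 - 1 / \<alpha>)\<close> implies one on the summable family
  \<open>a u powr (1 / \<alpha>)\<close>. If the sum is 0, then the quotient is 0 as well, by the convention for division,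
  and no set is active since all \<open>a u\<close> vanish.\<close>

lemma finite_active_set:
  assumes \<alpha>: "1 < \<alpha>"
    and summ: "fin_summable (\<lambda>u. a u powr (1 / \<alpha>))" and \<delta>: "0 < \<delta>"
  shows "finite {u \<in> Fpow {1..}. \<delta> / fin_sum (\<lambda>u. a u powr (1 / \<alpha>)) < a u powr (1 - 1 / \<alpha>)}"
    (is "finite ?U")
proof (cases "fin_sum (\<lambda>u. a u powr (1 / \<alpha>)) = 0")
  case True
  have "a u = 0" if u: "u \<in> Fpow {1..}" for u
  proof -
    have "a u powr (1 / \<alpha>) \<le> 0"
      using sum_le_fin_sum[OF _ summ, of "{u}"] u True by simp
    then show ?thesis by simp
  qed
  then have "?U = {}" using True by auto
  then show ?thesis by (simp only: finite.emptyI)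
next
  case False
  let ?\<sigma> = "fin_sum (\<lambda>u. a u powr (1 / \<alpha>))"
  have "0 \<le> ?\<sigma>" using sum_le_fin_sum[OF _ summ, of "{}"] by simp
  then have \<sigma>: "0 < ?\<sigma>" using False by simp
  \<comment> \<open>The power that turns the exponent \<open>1 - 1 / \<alpha>\<close> into \<open>1 / \<alpha>\<close>.\<close>
  define e where "e = (1 / \<alpha>) / (1 - 1 / \<alpha>)"
  have pos: "0 < 1 - 1 / \<alpha>" using \<alpha> by simp
  then have e: "0 < e" "(1 - 1 / \<alpha>) * e = 1 / \<alpha>" using \<alpha> by (auto simp: e_def)
  have "?U \<subseteq> {u \<in> Fpow {1..}. (\<delta> / ?\<sigma>) powr e \<le> a u powr (1 / \<alpha>)}"
  proof safe
    fix u assume "\<delta> / ?\<sigma> < a u powr (1 - 1 / \<alpha>)"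
    then have "(\<delta> / ?\<sigma>) powr e \<le> (a u powr (1 - 1 / \<alpha>)) powr e"
      using e \<delta> \<sigma> by (intro powr_mono2) auto
    then show "(\<delta> / ?\<sigma>) powr e \<le> a u powr (1 / \<alpha>)" by (simp only: powr_powr e(2))
  qed
  moreover have "finite {u \<in> Fpow {1..}. (\<delta> / ?\<sigma>) powr e \<le> a u powr (1 / \<alpha>)}"
    using \<delta> \<sigma> by (intro finite_above_threshold[OF _ summ]) auto
  ultimately show ?thesis by (rule finite_subset)
qed

text \<open>Writing \<open>a u\<close> as \<open>a u powr (1 - 1 / \<alpha>) * a u powr (1 / \<alpha>)\<close> and bounding the first factor by the
  threshold leaves \<open>\<delta>\<close> times a part of the sum divided by the whole sum.\<close>

lemma sum_outside_active_set:
  assumes nonneg: "\<And>u. u \<in> Fpow {1..} \<Longrightarrow> 0 \<le> a u" and \<delta>: "0 < \<delta>"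
    and summ: "fin_summable (\<lambda>u. a u powr (1 / \<alpha>))"
    and V: "finite V" "V \<subseteq> Fpow {1..}"
    and out: "\<And>u. u \<in> V \<Longrightarrow> a u powr (1 - 1 / \<alpha>) \<le> \<delta> / fin_sum (\<lambda>u. a u powr (1 / \<alpha>))"
  shows "sum a V \<le> \<delta>"
proof -
  let ?\<sigma> = "fin_sum (\<lambda>u. a u powr (1 / \<alpha>))"
  have \<sigma>V: "(\<Sum>u\<in>V. a u powr (1 / \<alpha>)) \<le> ?\<sigma>"
    using V by (intro sum_le_fin_sum[OF _ summ]) auto
  have \<sigma>: "0 \<le> ?\<sigma>" using sum_le_fin_sum[OF _ summ, of "{}"] by simp
  have "sum a V \<le> (\<Sum>u\<in>V. \<delta> / ?\<sigma> * a u powr (1 / \<alpha>))"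
  proof (rule sum_mono)
    fix u assume u: "u \<in> V"
    have "a u = a u powr (1 - 1 / \<alpha>) * a u powr (1 / \<alpha>)"
      using nonneg[of u] u V by (auto simp flip: powr_add)
    also have "\<dots> \<le> \<delta> / ?\<sigma> * a u powr (1 / \<alpha>)"
      using out[OF u] by (intro mult_right_mono) auto
    finally show "a u \<le> \<delta> / ?\<sigma> * a u powr (1 / \<alpha>)" .
  qed
  also have "\<dots> = \<delta> / ?\<sigma> * (\<Sum>u\<in>V. a u powr (1 / \<alpha>))" by (simp add: sum_distrib_left)
  also have "\<dots> \<le> \<delta> / ?\<sigma> * ?\<sigma>"
    using \<sigma>V \<sigma> \<delta> by (intro mult_left_mono) auto
  also have "\<dots> \<le> \<delta>" using \<delta> by simp
  finally show ?thesis .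
qed

section \<open>The optimal allocation of quadrature points\<close>

text \<open>With \<open>b = G\<^sub>u B\<^sub>u\<close> and \<open>c\<close> the cost of one evaluation, \<open>(b / c) powr (1 / (q + 1))\<close> is, up to a factor
  common to all \<open>u\<close>, the number of points that Lagrange multipliers give for minimising \<open>\<Sum> h c\<close> under
  a constraint on \<open>\<Sum> b / h powr q\<close>. This lemma and the next one say that the two quantities then have
  the same size.\<close>

lemma allocation_cost_term:
  fixes b c q :: real
  assumes "0 < b" "0 < c" "0 < q"
  shows "(b / c) powr (1 / (q + 1)) * c = c powr (q / (q + 1)) * b powr (1 / (q + 1))"
proof -
  have "q / (q + 1) = 1 - 1 / (q + 1)" using assms by (simp add: field_simps)
  then have "c powr (q / (q + 1)) = c powr (1 - 1 / (q + 1))" by simp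
  also have "\<dots> = c / c powr (1 / (q + 1))" using assms by (simp add: powr_diff)
  finally show ?thesis using assms by (simp add: powr_divide)
qed

lemma allocation_error_term:
  fixes b c q :: real
  assumes "0 < b" "0 < c" "0 < q"
  shows "b / ((b / c) powr (1 / (q + 1))) powr q = c powr (q / (q + 1)) * b powr (1 / (q + 1))"
proof -
  have "1 / (q + 1) = 1 - q / (q + 1)" using assms by (simp add: field_simps)
  then have "b powr (1 / (q + 1)) = b powr (1 - q / (q + 1))" by simp
  also have "\<dots> = b / b powr (q / (q + 1))" using assms by (simp add: powr_diff)
  finally have "b powr (1 / (q + 1)) = b / b powr (q / (q + 1))" .
  moreover have "((b / c) powr (1 / (q + 1))) powr q = b powr (q / (q + 1)) / c powr (q / (q + 1))"
    using assms by (simp add: powr_powr powr_divide)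
  ultimately show ?thesis by simp
qed

text \<open>All terms share the factor \<open>(2 / \<epsilon> * K) powr (1 / q)\<close>, and by \<open>allocation_cost_term\<close> the rest of them
  adds up to \<open>K\<close>.\<close>

lemma allocation_cost:
  fixes b c h :: "'a \<Rightarrow> real" and q \<epsilon> :: real and U :: "'a set"
  defines "K \<equiv> \<Sum>v\<in>U. c v powr (q / (q + 1)) * b v powr (1 / (q + 1))"
  assumes pos: "\<And>u. u \<in> U \<Longrightarrow> 0 < b u" "\<And>u. u \<in> U \<Longrightarrow> 0 < c u"
    and q: "0 < q" and \<epsilon>: "0 < \<epsilon>"
    and h: "\<And>u. h u = (2 / \<epsilon> * K) powr (1 / q) * (b u / c u) powr (1 / (q + 1))"
  shows "(\<Sum>u\<in>U. h u * c u) = (2 / \<epsilon>) powr (1 / q) * K powr (1 + 1 / q)"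
proof -
  have K: "0 \<le> K" unfolding K_def by (intro sum_nonneg) auto
  have "(\<Sum>u\<in>U. h u * c u)
      = (\<Sum>u\<in>U. (2 / \<epsilon> * K) powr (1 / q) * (c u powr (q / (q + 1)) * b u powr (1 / (q + 1))))"
    using pos q by (intro sum.cong refl) (simp add: h mult.assoc allocation_cost_term)
  also have "\<dots> = (2 / \<epsilon> * K) powr (1 / q) * K" by (simp add: K_def sum_distrib_left)
  also have "\<dots> = (2 / \<epsilon>) powr (1 / q) * (K powr (1 / q) * K powr 1)"
    using K \<epsilon> by (subst powr_mult) auto
  also have "\<dots> = (2 / \<epsilon>) powr (1 / q) * K powr (1 + 1 / q)"
    by (simp only: powr_add[symmetric] add.commute)
  finally show ?thesis .
qed

text \<open>Rounding down is harmless because the error bound of a rule with \<open>n\<close> points has \<open>n + 1\<close> in the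
  denominator, and \<open>\<lfloor>h\<rfloor> + 1 \<ge> h\<close>. With \<open>h\<close> in place of \<open>n + 1\<close> the terms add up to \<open>\<epsilon> / (2 K) * K\<close>,
  by \<open>allocation_error_term\<close>; the factor in front of \<open>h\<close> is chosen for this.\<close>

lemma allocation_error:
  fixes b c h :: "'a \<Rightarrow> real" and q \<epsilon> :: real and U :: "'a set"
  defines "K \<equiv> \<Sum>v\<in>U. c v powr (q / (q + 1)) * b v powr (1 / (q + 1))"
  assumes U: "finite U" and pos: "\<And>u. u \<in> U \<Longrightarrow> 0 < b u" "\<And>u. u \<in> U \<Longrightarrow> 0 < c u"
    and q: "0 < q" and \<epsilon>: "0 < \<epsilon>"
    and h: "\<And>u. h u = (2 / \<epsilon> * K) powr (1 / q) * (b u / c u) powr (1 / (q + 1))"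
  shows "(\<Sum>u\<in>U. b u / (real (nat \<lfloor>h u\<rfloor>) + 1) powr q) \<le> \<epsilon> / 2"
proof (cases "U = {}")
  case False
  then have K: "0 < K"
    unfolding K_def using U pos by (intro sum_pos mult_pos_pos) (fastforce simp: less_le)+
  have "(\<Sum>u\<in>U. b u / (real (nat \<lfloor>h u\<rfloor>) + 1) powr q)
      \<le> (\<Sum>u\<in>U. \<epsilon> / (2 * K) * (c u powr (q / (q + 1)) * b u powr (1 / (q + 1))))"
  proof (rule sum_mono)
    fix u assume u: "u \<in> U"
    have h0: "0 < h u" using pos[OF u] K \<epsilon> by (simp add: h)
    have "h u \<le> real (nat \<lfloor>h u\<rfloor>) + 1" using h0 by linarith
    then have "h u powr q \<le> (real (nat \<lfloor>h u\<rfloor>) + 1) powr q"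
      using h0 q by (intro powr_mono2) auto
    then have "b u / (real (nat \<lfloor>h u\<rfloor>) + 1) powr q \<le> b u / h u powr q"
      using h0 pos[OF u] by (intro divide_left_mono mult_pos_pos) auto
    also have "h u powr q = 2 / \<epsilon> * K * ((b u / c u) powr (1 / (q + 1))) powr q"
      using K \<epsilon> q by (simp add: h powr_mult powr_powr)
    also have "b u / \<dots> = \<epsilon> / (2 * K) * (b u / ((b u / c u) powr (1 / (q + 1))) powr q)"
      by simp
    also have "\<dots> = \<epsilon> / (2 * K) * (c u powr (q / (q + 1)) * b u powr (1 / (q + 1)))"
      using allocation_error_term[OF pos[OF u] q] by simp
    finally show "b u / (real (nat \<lfloor>h u\<rfloor>) + 1) powr q
      \<le> \<epsilon> / (2 * K) * (c u powr (q / (q + 1)) * b u powr (1 / (q + 1)))" .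
  qed
  also have "\<dots> = \<epsilon> / (2 * K) * K" by (simp add: K_def sum_distrib_left)
  also have "\<dots> = \<epsilon> / 2" using K by simp
  finally show ?thesis .
qed (use \<epsilon> in simp)

text \<open>The exponents match: \<open>q / (q + 1) * (1 + 1 / q) = 1\<close>, so the maximum leaves the sum with power 1.\<close>

lemma allocation_cost_Max:
  fixes b c :: "'a \<Rightarrow> real"
  assumes U: "finite U" and pos: "\<And>u. u \<in> U \<Longrightarrow> 0 < c u" and q: "0 < q"
  shows "(\<Sum>u\<in>U. c u powr (q / (q + 1)) * b u powr (1 / (q + 1))) powr (1 + 1 / q)
    \<le> (\<Sum>u\<in>U. b u powr (1 / (q + 1))) powr (1 + 1 / q) * Max0 c U"
proof (cases "U = {}")
  case False
  define M where "M = Max0 c U"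
  have M: "c u \<le> M" if "u \<in> U" for u
    using that U by (auto simp: M_def Max0_def)
  then have M0: "0 < M" using False pos by (meson ex_in_conv less_le_trans)
  have "(\<Sum>u\<in>U. c u powr (q / (q + 1)) * b u powr (1 / (q + 1)))
      \<le> (\<Sum>u\<in>U. M powr (q / (q + 1)) * b u powr (1 / (q + 1)))"
    using M pos q by (intro sum_mono mult_right_mono powr_mono2) (auto simp: less_imp_le)
  then have "(\<Sum>u\<in>U. c u powr (q / (q + 1)) * b u powr (1 / (q + 1))) powr (1 + 1 / q)
      \<le> (M powr (q / (q + 1)) * (\<Sum>u\<in>U. b u powr (1 / (q + 1)))) powr (1 + 1 / q)"
    using q by (intro powr_mono2 sum_nonneg) (auto simp: sum_distrib_left)
  also have "\<dots> = M powr (q / (q + 1) * (1 + 1 / q)) * (\<Sum>u\<in>U. b u powr (1 / (q + 1))) powr (1 + 1 / q)"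
    by (subst powr_mult) (auto simp: powr_powr sum_nonneg)
  also have "q / (q + 1) * (1 + 1 / q) = 1"
    using q by (simp add: divide_simps)
  finally show ?thesis using M0 by (simp add: M_def mult.commute)
qed (simp add: Max0_def)

section \<open>Error and cost of the algorithm\<close>

theorem theorem8:
  fixes D :: "real set" and \<rho> :: "real \<Rightarrow> real"
    and \<F> :: "(point \<Rightarrow> real) set"
    and dec :: "(point \<Rightarrow> real) \<Rightarrow> nat set \<Rightarrow> point \<Rightarrow> real"
    and F :: "nat set \<Rightarrow> (point \<Rightarrow> real) set"
    and nrm :: "nat set \<Rightarrow> (point \<Rightarrow> real) \<Rightarrow> real"
    and B G :: "nat set \<Rightarrow> real"
    and pound :: "nat \<Rightarrow> real"
    and w :: "nat set \<Rightarrow> nat \<Rightarrow> nat \<Rightarrow> real"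
    and p :: "nat set \<Rightarrow> nat \<Rightarrow> nat \<Rightarrow> point"
    and q \<epsilon> \<alpha> :: real
  defines "C \<equiv> \<lambda>u. enn2real (functional_norm (F u) (nrm u) (Int_u D \<rho> u))"
  defines "\<alpha>0 \<equiv> Sup (ereal ` {a. 0 < a \<and> fin_summable (\<lambda>u. (C u * B u) powr (1 / a))})"
  defines "U \<equiv> {u \<in> Fpow {1..}. (C u * B u) powr (1 - 1 / \<alpha>) >
                  (\<epsilon> / 2) / fin_sum (\<lambda>v. (C v * B v) powr (1 / \<alpha>))}"
  defines "h \<equiv> \<lambda>u. (2 / \<epsilon> * (\<Sum>v\<in>U. pound (card v) powr (q / (q + 1)) * (G v * B v) powr (1 / (q + 1))))
                       powr (1 / q)
                   * (G u * B u / pound (card u)) powr (1 / (q + 1))"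
  defines "n \<equiv> \<lambda>u. nat \<lfloor>h u\<rfloor>"
  defines "A \<equiv> \<lambda>f. \<Sum>u\<in>U. quad (w u) (p u) (n u) (dec f u)"
  assumes D_borel: "D \<in> sets borel"
    and rho_measurable: "\<rho> \<in> borel_measurable (lebesgue_on D)"
    and rho_nonneg: "\<And>x. x \<in> D \<Longrightarrow> 0 \<le> \<rho> x"
    and mu1_prob: "prob_space (mu1 D \<rho>)"
    and A1: "\<And>f. f \<in> \<F> \<Longrightarrow> converges_dominantly (mu D \<rho>) (trunc (dec f)) f"
    and A2_space: "\<And>u. u \<in> Fpow {1..} \<Longrightarrow> normed_fun_space (dom_prod D u) (F u) (nrm u)"
    and A2_mem: "\<And>f u. f \<in> \<F> \<Longrightarrow> u \<in> Fpow {1..} \<Longrightarrow> dec f u \<in> F u \<and> nrm u (dec f u) \<le> B u"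
    and A2_pos: "\<And>u. u \<in> Fpow {1..} \<Longrightarrow> 0 < B u"
    and A2_const: "F {} = range (\<lambda>c. \<lambda>x\<in>dom_prod D {}. c)"
    and A2_const_norm: "\<And>c. nrm {} (\<lambda>x\<in>dom_prod D {}. c) = \<bar>c\<bar>"
    and A2_eval: "\<And>u x. u \<in> Fpow {1..} \<Longrightarrow> x \<in> dom_prod D u \<Longrightarrow>
           continuous_functional (dom_prod D u) (F u) (nrm u) (\<lambda>g. g x)"
    and A3_meas: "\<And>u g. u \<in> Fpow {1..} \<Longrightarrow> g \<in> F u \<Longrightarrow> g \<in> borel_measurable (leb_prod D u)"
    and A3_integrable: "\<And>u g. u \<in> Fpow {1..} \<Longrightarrow> g \<in> F u \<Longrightarrow>
           integrable (leb_prod D u) (\<lambda>x. g x * rho_prod \<rho> u x)"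
    and A3_norm: "\<And>u. u \<in> Fpow {1..} \<Longrightarrow> functional_norm (F u) (nrm u) (Int_u D \<rho> u) < \<top>"
    and A4: "\<alpha>0 > 1"
    and A5_pos: "\<And>k. 0 < pound k"
    and A5_mono: "mono pound"
    and A6_q: "0 < q"
    and A6_points: "\<And>u m i. u \<in> Fpow {1..} \<Longrightarrow> i \<in> {1..m} \<Longrightarrow> p u m i \<in> dom_prod D u"
    and A6_G: "\<And>u. u \<in> Fpow {1..} \<Longrightarrow> 0 < G u"
    and A6_error: "\<And>u m. u \<in> Fpow {1..} \<Longrightarrow>
           functional_norm (F u) (nrm u) (\<lambda>g. Int_u D \<rho> u g - quad (w u) (p u) m g)
             \<le> ennreal (G u / (real m + 1) powr q)"
    and eps: "0 < \<epsilon>"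
    and alpha: "1 < \<alpha>" "ereal \<alpha> < \<alpha>0"
  shows "(finite U) \<and>
      ((SUP f\<in>\<F>. ennreal \<bar>Int_inf D \<rho> f - A f\<bar>) \<le> ennreal \<epsilon>) \<and>
      ((\<Sum>u\<in>U. real (n u) * pound (card u)) \<le> (\<Sum>u\<in>U. h u * pound (card u))) \<and>
      ((\<Sum>u\<in>U. h u * pound (card u))
           \<le> (2 / \<epsilon>) powr (1 / q) *
              (\<Sum>u\<in>U. pound (card u) powr (q / (q + 1)) * (G u * B u) powr (1 / (q + 1))) powr (1 + 1 / q)) \<and>
      ((2 / \<epsilon>) powr (1 / q) *
              (\<Sum>u\<in>U. pound (card u) powr (q / (q + 1)) * (G u * B u) powr (1 / (q + 1))) powr (1 + 1 / q)
           \<le> (2 / \<epsilon>) powr (1 / q) *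
              (\<Sum>u\<in>U. (G u * B u) powr (1 / (q + 1))) powr (1 + 1 / q) *
              Max0 (\<lambda>u. pound (card u)) U)"
proof -
  define a where "a = (\<lambda>u. C u * B u)"
  define b where "b = (\<lambda>u. G u * B u)"
  have a0: "0 \<le> a u" if "u \<in> Fpow {1..}" for u
    using A2_pos[OF that] by (simp add: a_def C_def)
  have b0: "0 < b u" if "u \<in> Fpow {1..}" for u
    using A2_pos[OF that] A6_G[OF that] by (simp add: b_def)
  have UF: "U \<subseteq> Fpow {1..}" by (auto simp: U_def)
  have U_eq: "U = {u \<in> Fpow {1..}. (\<epsilon> / 2) / fin_sum (\<lambda>u. a u powr (1 / \<alpha>)) < a u powr (1 - 1 / \<alpha>)}"
    by (simp add: U_def a_def)

  obtain a' where a': "fin_summable (\<lambda>u. a u powr (1 / a'))" "\<alpha> < a'"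
    using alpha(2) unfolding \<alpha>0_def less_Sup_iff by (auto simp: a_def)
  have summ: "fin_summable (\<lambda>u. a u powr (1 / \<alpha>))"
    by (rule fin_summable_powr_mono[OF _ _ a'(1)]) (use a'(2) alpha(1) in \<open>auto simp: frac_le\<close>)
  have finU: "finite U"
    unfolding U_eq using eps by (intro finite_active_set alpha(1) summ) auto

  \<comment> \<open>\<open>enn2real\<close> sends \<open>\<top>\<close> to 0, so \<open>C u\<close> bounds the functional only because its norm is finite.\<close>
  have Int_bound: "\<bar>Int_u D \<rho> u g\<bar> \<le> C u * nrm u g" if u: "u \<in> Fpow {1..}" and g: "g \<in> F u" for u g
  proof (rule functional_norm_bound[OF A2_space[OF u] _ _ _ g])
    show "functional_norm (F u) (nrm u) (Int_u D \<rho> u) \<le> ennreal (C u)"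
      using A3_norm[OF u] by (simp add: C_def)
    show "0 \<le> C u" by (simp add: C_def)
  qed (rule Int_u_scale)
  have quad_bound: "\<bar>Int_u D \<rho> u g - quad (w u) (p u) m g\<bar> \<le> G u / (real m + 1) powr q * nrm u g"
    if u: "u \<in> Fpow {1..}" and g: "g \<in> F u" for u g m
  proof (rule functional_norm_bound[OF A2_space[OF u] _ A6_error[OF u] _ g])
    show "Int_u D \<rho> u (\<lambda>x\<in>dom_prod D u. c * f x) - quad (w u) (p u) m (\<lambda>x\<in>dom_prod D u. c * f x)
        = c * (Int_u D \<rho> u f - quad (w u) (p u) m f)" for c f
      by (simp only: Int_u_scale quad_scale[OF A6_points[OF u]] right_diff_distrib)
    show "0 \<le> G u / (real m + 1) powr q" using A6_G[OF u] by simp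
  qed

  have error: "\<bar>Int_inf D \<rho> f - A f\<bar> \<le> \<epsilon>" if f: "f \<in> \<F>" for f
  proof -
    have dec: "dec f u \<in> F u" "nrm u (dec f u) \<le> B u" if "u \<in> Fpow {1..}" for u
      using A2_mem[OF f that] by auto
    have C0: "0 \<le> C u" for u by (simp add: C_def)
    have Int_le: "\<bar>Int_u D \<rho> u (dec f u)\<bar> \<le> a u" if u: "u \<in> Fpow {1..}" for u
      unfolding a_def
      by (rule order_trans[OF Int_bound[OF u dec(1)[OF u]] mult_left_mono[OF dec(2)[OF u] C0]])
    have quad_le: "\<bar>Int_u D \<rho> u (dec f u) - quad (w u) (p u) (n u) (dec f u)\<bar>
        \<le> b u / (real (n u) + 1) powr q" if u: "u \<in> Fpow {1..}" for u
    proof -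
      have "G u / (real (n u) + 1) powr q * nrm u (dec f u) \<le> G u / (real (n u) + 1) powr q * B u"
        using A6_G[OF u] by (intro mult_left_mono dec(2)[OF u]) simp
      then show ?thesis
        using quad_bound[OF u dec(1)[OF u], of "n u"] by (simp add: b_def)
    qed
    \<comment> \<open>The bound holds at each truncation level that covers the active set, so it survives the limit.\<close>
    have level: "\<bar>Int_inf D \<rho> (trunc (dec f) d) - A f\<bar> \<le> \<epsilon>" if d: "U \<subseteq> Pow {1..d}" for d
    proof -
      let ?I = "\<lambda>u. Int_u D \<rho> u (dec f u)"
      have "Int_inf D \<rho> (trunc (dec f) d) = (\<Sum>u\<in>Pow {1..d}. ?I u)"
      proof (rule Int_inf_trunc)
        fix u assume "u \<in> Pow {1..d}"
        then have u: "u \<in> Fpow {1..}" using Pow_subset_Fpow by blast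
        then have u': "finite u" "u \<subseteq> {1..}" by (auto simp: Fpow_def)
        note cyl = cylinder_integral[OF D_borel rho_measurable rho_nonneg mu1_prob u'
            A3_meas[OF u dec(1)[OF u]] A3_integrable[OF u dec(1)[OF u]]]
        show "integrable (mu D \<rho>) (\<lambda>x. dec f u (restrict x u))" by (rule cyl(1))
        show "Int_inf D \<rho> (\<lambda>x. dec f u (restrict x u)) = ?I u" by (rule cyl(2))
      qed
      also have "\<dots> = (\<Sum>u\<in>Pow {1..d} - U. ?I u) + (\<Sum>u\<in>U. ?I u)"
        by (rule sum.subset_diff[OF d]) simp
      finally have split: "Int_inf D \<rho> (trunc (dec f) d) - A f
          = (\<Sum>u\<in>Pow {1..d} - U. ?I u) + (\<Sum>u\<in>U. ?I u - quad (w u) (p u) (n u) (dec f u))"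
        by (simp add: A_def sum_subtractf)
      have "\<bar>\<Sum>u\<in>Pow {1..d} - U. ?I u\<bar> \<le> (\<Sum>u\<in>Pow {1..d} - U. a u)"
        by (rule order_trans[OF sum_abs]) (intro sum_mono Int_le, use Pow_subset_Fpow in blast)
      also have "\<dots> \<le> \<epsilon> / 2"
      proof (rule sum_outside_active_set[OF a0 _ summ])
        show "Pow {1..d} - U \<subseteq> Fpow {1..}" using Pow_subset_Fpow by blast
        fix u assume u: "u \<in> Pow {1..d} - U"
        then have "u \<in> Fpow {1..}" using Pow_subset_Fpow by blast
        then show "a u powr (1 - 1 / \<alpha>) \<le> (\<epsilon> / 2) / fin_sum (\<lambda>u. a u powr (1 / \<alpha>))"
          using u unfolding U_eq by (simp add: not_less)
      qed (use eps in simp_all)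
      finally have trunc_error: "\<bar>\<Sum>u\<in>Pow {1..d} - U. ?I u\<bar> \<le> \<epsilon> / 2" .
      have "\<bar>\<Sum>u\<in>U. ?I u - quad (w u) (p u) (n u) (dec f u)\<bar>
          \<le> (\<Sum>u\<in>U. b u / (real (n u) + 1) powr q)"
        by (rule order_trans[OF sum_abs]) (intro sum_mono quad_le, use UF in blast)
      also have "\<dots> \<le> \<epsilon> / 2"
        unfolding n_def using UF b0
        by (intro allocation_error[where c="\<lambda>u. pound (card u)"] finU A5_pos A6_q eps)
           (auto simp: h_def b_def)
      finally show ?thesis unfolding split using trunc_error by linarith
    qed
    obtain d0 where d0: "\<forall>d\<ge>d0. U \<subseteq> Pow {1..d}" using finite_family_bounded[OF finU UF] by blast
    have "(\<lambda>d. \<bar>Int_inf D \<rho> (trunc (dec f) d) - A f\<bar>) \<longlonglongrightarrow> \<bar>Int_inf D \<rho> f - A f\<bar>"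
      by (intro tendsto_intros Int_inf_dominated_limit A1 f)
    then show ?thesis
      by (rule LIMSEQ_le_const2) (use level d0 in blast)
  qed

  have h_nonneg: "0 \<le> h u" for u by (simp add: h_def)
  show ?thesis
  proof (intro conjI)
    show "finite U" by (rule finU)
    show "(SUP f\<in>\<F>. ennreal \<bar>Int_inf D \<rho> f - A f\<bar>) \<le> ennreal \<epsilon>"
      by (intro SUP_least ennreal_leI error)
    show "(\<Sum>u\<in>U. real (n u) * pound (card u)) \<le> (\<Sum>u\<in>U. h u * pound (card u))"
      using h_nonneg A5_pos by (intro sum_mono mult_right_mono) (auto simp: n_def less_imp_le)
    have "(\<Sum>u\<in>U. h u * pound (card u)) = (2 / \<epsilon>) powr (1 / q) *
        (\<Sum>u\<in>U. pound (card u) powr (q / (q + 1)) * b u powr (1 / (q + 1))) powr (1 + 1 / q)"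
      using UF b0 by (intro allocation_cost A5_pos A6_q eps) (auto simp: h_def b_def)
    then show "(\<Sum>u\<in>U. h u * pound (card u)) \<le> (2 / \<epsilon>) powr (1 / q) *
        (\<Sum>u\<in>U. pound (card u) powr (q / (q + 1)) * (G u * B u) powr (1 / (q + 1))) powr (1 + 1 / q)"
      by (simp add: b_def)
    show "(2 / \<epsilon>) powr (1 / q) *
        (\<Sum>u\<in>U. pound (card u) powr (q / (q + 1)) * (G u * B u) powr (1 / (q + 1))) powr (1 + 1 / q)
      \<le> (2 / \<epsilon>) powr (1 / q) * (\<Sum>u\<in>U. (G u * B u) powr (1 / (q + 1))) powr (1 + 1 / q) *
        Max0 (\<lambda>u. pound (card u)) U"
      unfolding mult.assoc by (intro mult_left_mono allocation_cost_Max finU A5_pos A6_q) simp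
  qed
qed

end
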